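(* Let $\mu,\nu>0$ with $\mu+\nu=1$. For each integer $N\ge1$ let $C_N$ be an integer with $1\le C_N\le N$, and let $(X_N(t))_{t\ge0}$ be the Engset process with $N$ sources, capacity $C_N$ and parameters $\nu,\mu$, started at $X_N(0)=C_N$. Let $T_0^{X_N}=\inf\{s\ge0:X_N(s)=0\}$. If $C_N=\eta N+O(1)$ as $N\to+\infty$ for some $\eta\in(0,1]$ with $\nu<\eta$, then the sequence of random variables $$\left(N(1-\nu)^N\,T_0^{X_N}\right)$$ converges in distribution, as $N\to+\infty$, to an exponential random variable with parameter $\nu$.
   Context: The Engset process $(X_N(t))_{t\ge0}$ with $N$ sources, capacity $C_N$ ($1\le C_N\le N$) and parameters $\nu,\mu>0$ is the continuous-time (right-continuous) birth and death Markov process on $\{0,1,\ldots,C_N\}$ with transition rates $q(x,x-1)=\mu x$ for $0\le x\le C_N$ and $q(x,x+1)=\nu(N-x)$ for $0\le x<C_N$ (no upward jump from $C_N$). The time scale is normalized so that $\mu+\nu=1$. An exponential random variable with parameter $\lambda$ has mean $1/\lambda$. *)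

theory Defs
  imports "HOL-Probability.Probability"
begin

text \<open>Standard Markov transition functions on a finite state space, with their transition rates,
  that is, the right derivatives at 0 of the off-diagonal entries. The rates on the diagonal are then
  determined by the condition that rows sum to 1, so the values \<open>q x x\<close> play no role.\<close>

definition markov_transition_function ::
  "nat set \<Rightarrow> (real \<Rightarrow> nat \<Rightarrow> nat \<Rightarrow> real) \<Rightarrow> bool" where
  "markov_transition_function S P \<longleftrightarrow>
     (\<forall>t\<ge>0. \<forall>x\<in>S. \<forall>y\<in>S. 0 \<le> P t x y) \<and>
     (\<forall>t\<ge>0. \<forall>x\<in>S. (\<Sum>y\<in>S. P t x y) = 1) \<and>
     (\<forall>x\<in>S. \<forall>y\<in>S. P 0 x y = (if x = y then 1 else 0)) \<and>
     (\<forall>s\<ge>0. \<forall>t\<ge>0. \<forall>x\<in>S. \<forall>y\<in>S. P (s + t) x y = (\<Sum>z\<in>S. P s x z * P t z y))"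

definition has_transition_rates ::
  "nat set \<Rightarrow> (real \<Rightarrow> nat \<Rightarrow> nat \<Rightarrow> real) \<Rightarrow> (nat \<Rightarrow> nat \<Rightarrow> real) \<Rightarrow> bool" where
  "has_transition_rates S P q \<longleftrightarrow>
     (\<forall>x\<in>S. \<forall>y\<in>S. x \<noteq> y \<longrightarrow> ((\<lambda>t. P t x y) has_real_derivative q x y) (at_right 0))"

text \<open>Time-homogeneous Markov property: for \<open>J\<close> ranging over finite sets of times up to \<open>s\<close>,
  the event \<open>\<forall>u\<in>J. X u \<omega> = \<xi> u\<close> is an arbitrary cylinder event of the past.\<close>

definition markov_property ::
  "'a measure \<Rightarrow> nat set \<Rightarrow> (real \<Rightarrow> nat \<Rightarrow> nat \<Rightarrow> real) \<Rightarrow> (real \<Rightarrow> 'a \<Rightarrow> nat) \<Rightarrow> bool" where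
  "markov_property M S P X \<longleftrightarrow>
     (\<forall>s\<ge>0. \<forall>t\<ge>0. \<forall>J \<xi>. \<forall>x\<in>S. \<forall>y\<in>S.
        finite J \<longrightarrow> J \<subseteq> {0..s} \<longrightarrow>
        \<P>(\<omega> in M. X s \<omega> = x \<and> (\<forall>u\<in>J. X u \<omega> = \<xi> u)) > 0 \<longrightarrow>
        \<P>(\<omega> in M. X (s + t) \<omega> = y \<bar> X s \<omega> = x \<and> (\<forall>u\<in>J. X u \<omega> = \<xi> u)) = P t x y)"

text \<open>Right continuity refers to the discrete topology on \<^typ>\<open>nat\<close>. Only times \<open>t \<ge> 0\<close> matter;
  the initial distribution is left unspecified.\<close>

definition finite_markov_process ::
  "'a measure \<Rightarrow> nat set \<Rightarrow> (nat \<Rightarrow> nat \<Rightarrow> real) \<Rightarrow> (real \<Rightarrow> 'a \<Rightarrow> nat) \<Rightarrow> bool" where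
  "finite_markov_process M S q X \<longleftrightarrow>
     prob_space M \<and> finite S \<and>
     (\<forall>t\<ge>0. X t \<in> M \<rightarrow>\<^sub>M count_space S) \<and>
     (\<forall>\<omega>\<in>space M. \<forall>t\<ge>0. continuous (at_right t) (\<lambda>s. X s \<omega>)) \<and>
     (\<exists>P. markov_transition_function S P \<and> has_transition_rates S P q \<and> markov_property M S P X)"

definition engset_rate :: "nat \<Rightarrow> nat \<Rightarrow> real \<Rightarrow> real \<Rightarrow> nat \<Rightarrow> nat \<Rightarrow> real" where
  "engset_rate N C \<nu> \<mu> x y =
     (if x = Suc y \<and> x \<le> C then \<mu> * real x
      else if y = Suc x \<and> x < C then \<nu> * (real N - real x)
      else 0)"

definition engset_process ::
  "nat \<Rightarrow> nat \<Rightarrow> real \<Rightarrow> real \<Rightarrow> 'a measure \<Rightarrow> (real \<Rightarrow> 'a \<Rightarrow> nat) \<Rightarrow> bool" where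
  "engset_process N C \<nu> \<mu> M X \<longleftrightarrow> finite_markov_process M {0..C} (engset_rate N C \<nu> \<mu>) X"

text \<open>Valued in \<^typ>\<open>ennreal\<close> so that the infimum of the empty set is \<open>\<infinity>\<close>. Since
  \<^const>\<open>weak_conv_m\<close> is about measures on \<^typ>\<open>real\<close>, laws of hitting times are taken after
  \<^const>\<open>enn2real\<close>, which sends \<open>\<infinity>\<close> to 0. Weak convergence to a law without an atom at 0
  still forces the probability of \<open>\<infinity>\<close> to vanish in the limit.\<close>

definition hitting_time :: "(real \<Rightarrow> 'a \<Rightarrow> nat) \<Rightarrow> nat \<Rightarrow> 'a \<Rightarrow> ennreal" where
  "hitting_time X a \<omega> = (INF s\<in>{s. 0 \<le> s \<and> X s \<omega> = a}. ennreal s)"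

end

theory Submission
  imports Defs "HOL-Real_Asymp.Real_Asymp"
begin

text \<open>The mean hitting time \<open>m x\<close> of 0 from \<open>x\<close> solves \<open>L m = -1\<close> off 0, where \<open>L\<close> is the generator. From state 1
  the process escapes upwards with probability close to 1 when \<open>N\<close> is large, so \<open>m\<close> is nearly constant on
  \<open>{1..C}\<close>, hence nearly an eigenfunction of the semigroup killed at 0, with eigenvalue \<open>-1 / m C\<close>. Bounding the
  killed semigroup on a dyadic time grid by powers of its one-step bounds gives
  \<open>exp (- t / m 1) \<le> P(T > t) \<le> exp (- t / m C) * (m C / m 1)\<close>. For the Engset process \<open>m\<close> is explicit in terms of
  binomial weights, and both \<open>N (1 - \<nu>)^N m 1\<close> and \<open>N (1 - \<nu>)^N m C\<close> tend to \<open>1 / \<nu>\<close>: the first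
  by Chebyshev's inequality, the second because each further level costs a negligible mean time.\<close>

section \<open>Survival probabilities of finite Markov processes\<close>

locale finite_state_markov = prob_space M for M :: "'a measure" +
  fixes S :: "nat set" and P :: "real \<Rightarrow> nat \<Rightarrow> nat \<Rightarrow> real" and X :: "real \<Rightarrow> 'a \<Rightarrow> nat"
    and q :: "nat \<Rightarrow> nat \<Rightarrow> real"
  assumes finite_S: "finite S"
    and measurable_X: "t \<ge> 0 \<Longrightarrow> X t \<in> M \<rightarrow>\<^sub>M count_space S"
    and right_continuous: "\<omega> \<in> space M \<Longrightarrow> t \<ge> 0 \<Longrightarrow> continuous (at_right t) (\<lambda>s. X s \<omega>)"
    and transition: "markov_transition_function S P"
    and rates: "has_transition_rates S P q"
    and markov: "markov_property M S P X"
begin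

section \<open>Cylinder events and the Markov property\<close>

lemma X_in_S: "t \<ge> 0 \<Longrightarrow> \<omega> \<in> space M \<Longrightarrow> X t \<omega> \<in> S"
  using measurable_space[OF measurable_X] by auto

lemma X_event: "t \<ge> 0 \<Longrightarrow> {\<omega>\<in>space M. X t \<omega> \<in> B} \<in> events"
proof -
  assume t: "t \<ge> 0"
  have "{\<omega>\<in>space M. X t \<omega> \<in> B} = X t -` (B \<inter> S) \<inter> space M"
    using X_in_S[OF t] by auto
  then show ?thesis
    using measurable_sets[OF measurable_X[OF t], of "B \<inter> S"] by auto
qed

lemma X_eq_event: "t \<ge> 0 \<Longrightarrow> {\<omega>\<in>space M. X t \<omega> = x} \<in> events"
  using X_event[of t "{x}"] by simp

lemma cylinder_event:
  assumes "finite J" "\<And>u. u \<in> J \<Longrightarrow> u \<ge> 0"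
  shows "{\<omega>\<in>space M. \<forall>u\<in>J. X u \<omega> \<in> B u} \<in> events"
  using assms by (intro sets.sets_Collect_finite_All' sets.sets_Collect_finite_All X_event) auto

text \<open>In product form the Markov property extends to null conditioning events: the event on
  the left is then contained in a null event, and both sides vanish.\<close>

lemma point_cylinder_step:
  assumes "s \<ge> 0" "h \<ge> 0" "x \<in> S" "y \<in> S" "finite J" "J \<subseteq> {0..s}"
  shows "\<P>(\<omega> in M. X (s + h) \<omega> = y \<and> X s \<omega> = x \<and> (\<forall>u\<in>J. X u \<omega> = \<xi> u)) =
         \<P>(\<omega> in M. X s \<omega> = x \<and> (\<forall>u\<in>J. X u \<omega> = \<xi> u)) * P h x y"
    (is "prob ?A = prob ?B * _")
proof (cases "prob ?B > 0")
  case True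
  then have "\<P>(\<omega> in M. X (s + h) \<omega> = y \<bar> X s \<omega> = x \<and> (\<forall>u\<in>J. X u \<omega> = \<xi> u)) = P h x y"
    using markov assms unfolding markov_property_def by blast
  with True show ?thesis
    by (simp add: cond_prob_def field_simps)
next
  case False
  have ev: "?B \<in> events"
  proof (intro sets.sets_Collect_conj)
    show "{\<omega>\<in>space M. \<forall>u\<in>J. X u \<omega> = \<xi> u} \<in> events"
      using cylinder_event[of J "\<lambda>u. {\<xi> u}"] assms(5,6) by force
  qed (rule X_eq_event[OF assms(1)])
  have "prob ?A \<le> prob ?B"
    by (rule finite_measure_mono) (use ev in auto)
  moreover have "prob ?B = 0" "prob ?A \<ge> 0" using False
    by (auto simp: zero_less_measure_iff)
  ultimately show ?thesis by simp
qed

text \<open>A past confined to a finite set \<open>B\<close> splits into finitely many exact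
  trajectories on \<open>J\<close>, and the Markov property gives the same factor
  \<open>P h x y\<close> for each of them.\<close>

lemma cylinder_step:
  assumes "s \<ge> 0" "h \<ge> 0" "x \<in> S" "y \<in> S" "finite J" "J \<subseteq> {0..s}" "B \<subseteq> S"
  shows "\<P>(\<omega> in M. X (s + h) \<omega> = y \<and> X s \<omega> = x \<and> (\<forall>u\<in>J. X u \<omega> \<in> B)) =
         \<P>(\<omega> in M. X s \<omega> = x \<and> (\<forall>u\<in>J. X u \<omega> \<in> B)) * P h x y"
proof -
  \<comment> \<open>Extensional functions are used so that a path through \<open>B\<close> matches
    exactly one trajectory: \<open>prob_sum\<close> asks for unique existence.\<close>
  define F where "F = PiE J (\<lambda>_. B)"
  have "finite B" using assms(7) finite_S finite_subset by blast
  then have F: "finite F" unfolding F_def using assms(5) by (intro finite_PiE) auto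
  have uniq: "\<exists>!\<xi>. \<xi> \<in> F \<and> (\<forall>u\<in>J. X u \<omega> = \<xi> u)" if "\<forall>u\<in>J. X u \<omega> \<in> B" for \<omega>
  proof (rule ex1I[of _ "restrict (\<lambda>u. X u \<omega>) J"])
    show "restrict (\<lambda>u. X u \<omega>) J \<in> F \<and> (\<forall>u\<in>J. X u \<omega> = restrict (\<lambda>u. X u \<omega>) J u)"
      using that by (auto simp: F_def)
    fix \<xi> assume "\<xi> \<in> F \<and> (\<forall>u\<in>J. X u \<omega> = \<xi> u)"
    then show "\<xi> = restrict (\<lambda>u. X u \<omega>) J"
      unfolding F_def by (intro extensionalityI[of _ J]) (auto simp: PiE_def)
  qed
  have inF: "\<xi> \<in> F \<Longrightarrow> u \<in> J \<Longrightarrow> \<xi> u \<in> B" for \<xi> u by (auto simp: F_def)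
  have pos: "u \<in> J \<Longrightarrow> u \<ge> 0" for u using assms(6) by auto
  have ev1: "{\<omega>\<in>space M. X s \<omega> = x \<and> (\<forall>u\<in>J. X u \<omega> = \<xi> u)} \<in> events" for \<xi>
    using X_eq_event cylinder_event[of J "\<lambda>u. {\<xi> u}"] assms pos
    by (intro sets.sets_Collect_conj) auto
  have ev2: "{\<omega>\<in>space M. X s \<omega> = x \<and> (\<forall>u\<in>J. X u \<omega> \<in> B)} \<in> events"
    by (intro sets.sets_Collect_conj cylinder_event X_eq_event) (use assms pos in auto)
  have ev0: "{\<omega>\<in>space M. X (s + h) \<omega> = y} \<in> events" using X_eq_event assms by auto
  have "\<P>(\<omega> in M. X (s + h) \<omega> = y \<and> X s \<omega> = x \<and> (\<forall>u\<in>J. X u \<omega> \<in> B)) =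
     (\<Sum>\<xi>\<in>F. \<P>(\<omega> in M. X (s + h) \<omega> = y \<and> X s \<omega> = x \<and> (\<forall>u\<in>J. X u \<omega> = \<xi> u)))"
  proof (rule prob_sum[OF F])
    show "AE \<omega> in M. (\<forall>\<xi>\<in>F. X (s + h) \<omega> = y \<and> X s \<omega> = x \<and> (\<forall>u\<in>J. X u \<omega> = \<xi> u) \<longrightarrow>
          X (s + h) \<omega> = y \<and> X s \<omega> = x \<and> (\<forall>u\<in>J. X u \<omega> \<in> B)) \<and>
        (X (s + h) \<omega> = y \<and> X s \<omega> = x \<and> (\<forall>u\<in>J. X u \<omega> \<in> B) \<longrightarrow>
          (\<exists>!\<xi>. \<xi> \<in> F \<and> X (s + h) \<omega> = y \<and> X s \<omega> = x \<and> (\<forall>u\<in>J. X u \<omega> = \<xi> u)))"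
      by (rule AE_I2, intro conjI ballI impI) (use inF uniq in simp_all)
  qed (rule sets.sets_Collect_conj[OF ev1 ev0] sets.sets_Collect_conj[OF ev2 ev0])+
  also have "\<dots> = (\<Sum>\<xi>\<in>F. \<P>(\<omega> in M. X s \<omega> = x \<and> (\<forall>u\<in>J. X u \<omega> = \<xi> u))) * P h x y"
    unfolding sum_distrib_right using assms by (intro sum.cong point_cylinder_step) auto
  also have "(\<Sum>\<xi>\<in>F. \<P>(\<omega> in M. X s \<omega> = x \<and> (\<forall>u\<in>J. X u \<omega> = \<xi> u)))
     = \<P>(\<omega> in M. X s \<omega> = x \<and> (\<forall>u\<in>J. X u \<omega> \<in> B))"
  proof (rule prob_sum[OF F, symmetric])
    show "AE \<omega> in M. (\<forall>\<xi>\<in>F. X s \<omega> = x \<and> (\<forall>u\<in>J. X u \<omega> = \<xi> u) \<longrightarrow>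
          X s \<omega> = x \<and> (\<forall>u\<in>J. X u \<omega> \<in> B)) \<and>
        (X s \<omega> = x \<and> (\<forall>u\<in>J. X u \<omega> \<in> B) \<longrightarrow>
          (\<exists>!\<xi>. \<xi> \<in> F \<and> X s \<omega> = x \<and> (\<forall>u\<in>J. X u \<omega> = \<xi> u)))"
      by (rule AE_I2, intro conjI ballI impI) (use inF uniq in simp_all)
  qed (rule ev1 ev2)+
  finally show ?thesis .
qed

section \<open>The process watched on a time grid and killed at \<open>a\<close>\<close>

definition killed_law :: "nat \<Rightarrow> real \<Rightarrow> nat \<Rightarrow> nat \<Rightarrow> real" where
  "killed_law a h n x = \<P>(\<omega> in M. X (real n * h) \<omega> = x \<and> (\<forall>k\<le>n. X (real k * h) \<omega> \<noteq> a))"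

lemma grid_event:
  assumes "h \<ge> 0"
  shows "{\<omega>\<in>space M. \<forall>k\<le>n. X (real k * h) \<omega> \<noteq> a} \<in> events"
proof -
  have "{\<omega>\<in>space M. \<forall>k\<le>n. X (real k * h) \<omega> \<noteq> a} =
    {\<omega>\<in>space M. \<forall>u\<in>(\<lambda>k. real k * h) ` {..n}. X u \<omega> \<in> -{a}}" by auto
  also have "\<dots> \<in> events"
    using assms by (intro cylinder_event) auto
  finally show ?thesis .
qed

lemma killed_law_event:
  assumes "h \<ge> 0"
  shows "{\<omega>\<in>space M. X (real n * h) \<omega> = x \<and> (\<forall>k\<le>n. X (real k * h) \<omega> \<noteq> a)} \<in> events"
  using assms by (intro sets.sets_Collect_conj X_eq_event grid_event) auto

lemma killed_law_nonneg: "killed_law a h n x \<ge> 0"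
  by (simp add: killed_law_def)

text \<open>Survival on the grid is a past confined to \<open>S - {a}\<close>, so
  \<open>cylinder_step\<close> applies: the killed law evolves by the matrix \<open>P h\<close> with
  the row and column of \<open>a\<close> deleted.\<close>

lemma killed_law_Suc:
  assumes "h \<ge> 0" "y \<in> S - {a}"
  shows "killed_law a h (Suc n) y = (\<Sum>x\<in>S-{a}. killed_law a h n x * P h x y)"
proof -
  define J where "J = (\<lambda>k. real k * h) ` {..n}"
  have J: "finite J" "J \<subseteq> {0..real n * h}"
    using assms(1) by (auto simp: J_def mult_right_mono)
  have JB: "(\<forall>u\<in>J. X u \<omega> \<in> S - {a}) \<longleftrightarrow> (\<forall>k\<le>n. X (real k * h) \<omega> \<noteq> a)" if "\<omega> \<in> space M" for \<omega>
    using X_in_S[OF _ that] assms(1) by (auto simp: J_def)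
  have s: "real (Suc n) * h = real n * h + h" by (simp add: algebra_simps)
  have "killed_law a h n x * P h x y =
     \<P>(\<omega> in M. X (real (Suc n) * h) \<omega> = y \<and> X (real n * h) \<omega> = x \<and> (\<forall>k\<le>n. X (real k * h) \<omega> \<noteq> a))"
    if "x \<in> S - {a}" for x
  proof -
    have "killed_law a h n x = \<P>(\<omega> in M. X (real n * h) \<omega> = x \<and> (\<forall>u\<in>J. X u \<omega> \<in> S - {a}))"
      unfolding killed_law_def by (rule arg_cong[where f=prob], rule Collect_cong) (use JB in blast)
    also have "\<dots> * P h x y =
       \<P>(\<omega> in M. X (real (Suc n) * h) \<omega> = y \<and> X (real n * h) \<omega> = x \<and> (\<forall>u\<in>J. X u \<omega> \<in> S - {a}))"
      unfolding s using assms that J by (intro cylinder_step[symmetric]) auto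
    also have "\<dots> = \<P>(\<omega> in M. X (real (Suc n) * h) \<omega> = y \<and> X (real n * h) \<omega> = x
        \<and> (\<forall>k\<le>n. X (real k * h) \<omega> \<noteq> a))"
      by (rule arg_cong[where f=prob], rule Collect_cong) (use JB in blast)
    finally show ?thesis .
  qed
  then have "(\<Sum>x\<in>S-{a}. killed_law a h n x * P h x y) = (\<Sum>x\<in>S-{a}.
     \<P>(\<omega> in M. X (real (Suc n) * h) \<omega> = y \<and> X (real n * h) \<omega> = x \<and> (\<forall>k\<le>n. X (real k * h) \<omega> \<noteq> a)))"
    by (intro sum.cong) auto
  also have "\<dots> = killed_law a h (Suc n) y"
    unfolding killed_law_def
  proof (rule prob_sum[symmetric])
    show "AE \<omega> in M. (\<forall>x\<in>S - {a}. X (real (Suc n) * h) \<omega> = y \<and> X (real n * h) \<omega> = x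
          \<and> (\<forall>k\<le>n. X (real k * h) \<omega> \<noteq> a) \<longrightarrow>
          X (real (Suc n) * h) \<omega> = y \<and> (\<forall>k\<le>Suc n. X (real k * h) \<omega> \<noteq> a)) \<and>
        (X (real (Suc n) * h) \<omega> = y \<and> (\<forall>k\<le>Suc n. X (real k * h) \<omega> \<noteq> a) \<longrightarrow>
        (\<exists>!x. x \<in> S - {a} \<and> X (real (Suc n) * h) \<omega> = y \<and> X (real n * h) \<omega> = x
          \<and> (\<forall>k\<le>n. X (real k * h) \<omega> \<noteq> a)))"
      using X_in_S[of "real n * h"] assms by (intro AE_I2) (auto simp: le_Suc_eq)
    show "{\<omega>\<in>space M. X (real (Suc n) * h) \<omega> = y \<and> (\<forall>k\<le>Suc n. X (real k * h) \<omega> \<noteq> a)} \<in> events"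
      by (rule killed_law_event[OF assms(1)])
    show "{\<omega>\<in>space M. X (real (Suc n) * h) \<omega> = y \<and> X (real n * h) \<omega> = x
        \<and> (\<forall>k\<le>n. X (real k * h) \<omega> \<noteq> a)} \<in> events" for x
      by (rule sets.sets_Collect_conj[OF killed_law_event[OF assms(1)] X_eq_event])
        (simp add: assms(1))
  qed (use finite_S in simp)
  finally show ?thesis by simp
qed

lemma killed_law_0:
  assumes "AE \<omega> in M. X 0 \<omega> = x0" "x0 \<noteq> a"
  shows "killed_law a h 0 x = (if x = x0 then 1 else 0)"
proof -
  have "killed_law a h 0 x = \<P>(\<omega> in M. x = x0)"
    unfolding killed_law_def using assms X_eq_event[of 0 x] X_event[of 0 "-{a}"]
    by (intro prob_eq_AE) auto
  then show ?thesis by (simp add: prob_space)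
qed

lemma prob_grid:
  assumes "h \<ge> 0"
  shows "\<P>(\<omega> in M. \<forall>k\<le>n. X (real k * h) \<omega> \<noteq> a) = (\<Sum>x\<in>S-{a}. killed_law a h n x)"
  unfolding killed_law_def
proof (rule prob_sum)
  show "AE \<omega> in M. (\<forall>x\<in>S - {a}. X (real n * h) \<omega> = x \<and> (\<forall>k\<le>n. X (real k * h) \<omega> \<noteq> a) \<longrightarrow>
        (\<forall>k\<le>n. X (real k * h) \<omega> \<noteq> a)) \<and>
      ((\<forall>k\<le>n. X (real k * h) \<omega> \<noteq> a) \<longrightarrow>
      (\<exists>!x. x \<in> S - {a} \<and> X (real n * h) \<omega> = x \<and> (\<forall>k\<le>n. X (real k * h) \<omega> \<noteq> a)))"
    using X_in_S[of "real n * h"] assms by (intro AE_I2) auto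
qed (use finite_S in \<open>simp_all add: grid_event killed_law_event assms\<close>)

definition killed_expectation :: "nat \<Rightarrow> real \<Rightarrow> (nat \<Rightarrow> real) \<Rightarrow> nat \<Rightarrow> real" where
  "killed_expectation a h m n = (\<Sum>x\<in>S-{a}. killed_law a h n x * m x)"

lemma killed_expectation_Suc:
  assumes "h \<ge> 0"
  shows "killed_expectation a h m (Suc n) =
    (\<Sum>x\<in>S-{a}. killed_law a h n x * (\<Sum>y\<in>S-{a}. P h x y * m y))"
proof -
  have "killed_expectation a h m (Suc n) = (\<Sum>y\<in>S-{a}. \<Sum>x\<in>S-{a}. killed_law a h n x * (P h x y * m y))"
    unfolding killed_expectation_def
    by (intro sum.cong refl) (simp add: killed_law_Suc[OF assms] sum_distrib_right mult.assoc)
  also have "\<dots> = (\<Sum>x\<in>S-{a}. \<Sum>y\<in>S-{a}. killed_law a h n x * (P h x y * m y))"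
    by (rule sum.swap)
  finally show ?thesis by (simp add: sum_distrib_left)
qed

text \<open>The weights \<open>killed_law\<close> are nonnegative, so a pointwise one-step bound
  passes to the expectation; \<open>r \<ge> 0\<close> lets it be iterated. The lower bound below is
  symmetric.\<close>

lemma killed_expectation_le:
  assumes "h \<ge> 0" "r \<ge> 0" and "\<And>x. x \<in> S - {a} \<Longrightarrow> (\<Sum>y\<in>S-{a}. P h x y * m y) \<le> r * m x"
  shows "killed_expectation a h m n \<le> r ^ n * killed_expectation a h m 0"
proof (induction n)
  case (Suc n)
  have "killed_expectation a h m (Suc n) \<le> (\<Sum>x\<in>S-{a}. killed_law a h n x * (r * m x))"
    unfolding killed_expectation_Suc[OF assms(1)]
    by (intro sum_mono mult_left_mono assms killed_law_nonneg)
  also have "\<dots> = r * killed_expectation a h m n"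
    by (simp add: killed_expectation_def sum_distrib_left mult_ac)
  also have "\<dots> \<le> r * (r ^ n * killed_expectation a h m 0)"
    by (intro mult_left_mono Suc assms)
  finally show ?case by (simp add: mult_ac)
qed simp

lemma killed_expectation_ge:
  assumes "h \<ge> 0" "r \<ge> 0" and "\<And>x. x \<in> S - {a} \<Longrightarrow> r * m x \<le> (\<Sum>y\<in>S-{a}. P h x y * m y)"
  shows "r ^ n * killed_expectation a h m 0 \<le> killed_expectation a h m n"
proof (induction n)
  case (Suc n)
  have "r * (r ^ n * killed_expectation a h m 0) \<le> r * killed_expectation a h m n"
    by (intro mult_left_mono Suc assms)
  also have "\<dots> = (\<Sum>x\<in>S-{a}. killed_law a h n x * (r * m x))"
    by (simp add: killed_expectation_def sum_distrib_left mult_ac)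
  also have "\<dots> \<le> killed_expectation a h m (Suc n)"
    unfolding killed_expectation_Suc[OF assms(1)]
    by (intro sum_mono mult_left_mono assms killed_law_nonneg)
  finally show ?case by (simp add: mult_ac)
qed simp

lemma killed_expectation_0:
  assumes "AE \<omega> in M. X 0 \<omega> = x0" "x0 \<in> S - {a}"
  shows "killed_expectation a h m 0 = m x0"
proof -
  have "killed_expectation a h m 0 = (\<Sum>x\<in>S-{a}. if x = x0 then m x0 else 0)"
    unfolding killed_expectation_def using assms by (intro sum.cong) (auto simp: killed_law_0)
  then show ?thesis using assms finite_S by simp
qed

section \<open>Generator and one-step estimates\<close>

lemma generator_derivative:
  assumes x: "x \<in> S" and ma: "m a = 0"
  shows "((\<lambda>h. \<Sum>y\<in>S-{a}. P h x y * m y) has_real_derivative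
     (\<Sum>y\<in>S-{x}. q x y * (m y - m x))) (at_right 0)"
proof -
  \<comment> \<open>Since \<open>m a = 0\<close>, the state \<open>a\<close> can be put back into
    the sum. Rows of \<open>P h\<close> sum to 1, so everything is expressed through differences
    \<open>m y - m x\<close>; these vanish at \<open>y = x\<close>, which leaves only off-diagonal
    rates to differentiate.\<close>
  have eq: "(\<Sum>y\<in>S-{a}. P h x y * m y) = m x + (\<Sum>y\<in>S-{x}. P h x y * (m y - m x))" if "h \<ge> 0" for h
  proof -
    have "(\<Sum>y\<in>S-{a}. P h x y * m y) = (\<Sum>y\<in>S. P h x y * m y)"
      using finite_S ma by (intro sum.mono_neutral_left) auto
    also have "\<dots> = (\<Sum>y\<in>S. P h x y * (m y - m x)) + m x * (\<Sum>y\<in>S. P h x y)"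
      by (simp add: sum_distrib_left sum_distrib_right sum.distrib[symmetric] algebra_simps)
    also have "(\<Sum>y\<in>S. P h x y) = 1"
      using transition that x unfolding markov_transition_function_def by blast
    also have "(\<Sum>y\<in>S. P h x y * (m y - m x)) = (\<Sum>y\<in>S-{x}. P h x y * (m y - m x))"
      using finite_S x by (simp add: sum.remove)
    finally show ?thesis by simp
  qed
  have "((\<lambda>h. m x + (\<Sum>y\<in>S-{x}. P h x y * (m y - m x))) has_real_derivative
     (\<Sum>y\<in>S-{x}. q x y * (m y - m x))) (at_right 0)"
    using rates x unfolding has_transition_rates_def
    by (auto intro!: derivative_eq_intros)
  moreover have "eventually (\<lambda>h. (\<Sum>y\<in>S-{a}. P h x y * m y) = m x + (\<Sum>y\<in>S-{x}. P h x y * (m y - m x))) (at_right 0)"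
    using eventually_at_right_less[of "0::real"] by eventually_elim (simp add: eq)
  ultimately show ?thesis
    using eq[of 0] by (subst has_field_derivative_cong_eventually) auto
qed

text \<open>One step of length \<open>h\<close> lowers \<open>m\<close> by \<open>h\<close> up to an
  error below \<open>e * h\<close>. Since \<open>m x / hi \<le> 1 \<le> m x / lo\<close>, this
  additive loss becomes a multiplicative one. As \<open>S\<close> is finite, one threshold for
  \<open>h\<close> serves all states.\<close>

lemma one_step_bounds:
  assumes m: "m a = 0" "\<And>x. x \<in> S - {a} \<Longrightarrow> lo \<le> m x \<and> m x \<le> hi" "lo > 0"
    and gen: "\<And>x. x \<in> S - {a} \<Longrightarrow> (\<Sum>y\<in>S-{x}. q x y * (m y - m x)) = -1"
    and e: "e > 0" "e < 1"
  shows "eventually (\<lambda>h. \<forall>x\<in>S-{a}. (1 - (1 + e) * h / lo) * m x \<le> (\<Sum>y\<in>S-{a}. P h x y * m y) \<and>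
           (\<Sum>y\<in>S-{a}. P h x y * m y) \<le> (1 - (1 - e) * h / hi) * m x) (at_right 0)"
proof -
  have "eventually (\<lambda>h. (1 - (1 + e) * h / lo) * m x \<le> (\<Sum>y\<in>S-{a}. P h x y * m y) \<and>
           (\<Sum>y\<in>S-{a}. P h x y * m y) \<le> (1 - (1 - e) * h / hi) * m x) (at_right 0)"
    if x: "x \<in> S - {a}" for x
  proof -
    let ?G = "\<lambda>h. \<Sum>y\<in>S-{a}. P h x y * m y"
    have G0: "?G 0 = m x"
    proof -
      have "?G 0 = (\<Sum>y\<in>S-{a}. if y = x then m x else 0)"
        using transition x unfolding markov_transition_function_def by (intro sum.cong) auto
      then show ?thesis using finite_S x by simp
    qed
    have "(?G has_real_derivative -1) (at_right 0)"
      using generator_derivative[of x m a] gen[OF x] x m(1) by auto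
    then have "((\<lambda>h. (?G h - m x) / h) \<longlongrightarrow> -1) (at_right 0)"
      by (simp add: has_field_derivative_iff G0)
    then have "eventually (\<lambda>h. dist ((?G h - m x) / h) (-1) < e) (at_right 0)"
      using e by (simp add: tendsto_iff)
    then show ?thesis
      using eventually_at_right_less[of "0::real"]
    proof eventually_elim
      case (elim h)
      then have h: "h > 0" by simp
      from elim have "-(1 + e) < (?G h - m x) / h" "(?G h - m x) / h < -(1 - e)"
        by (auto simp: dist_real_def abs_less_iff)
      then have b: "-(1 + e) * h \<le> ?G h - m x" "?G h - m x \<le> -(1 - e) * h"
        using h by (auto simp: pos_less_divide_eq pos_divide_less_eq)
      have mx: "lo \<le> m x" "m x \<le> hi" using m(2)[OF x] by auto
      have "(1 + e) * h * 1 \<le> (1 + e) * h * (m x / lo)"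
        using h e mx m(3) by (intro mult_left_mono) auto
      moreover have "(1 - e) * h * (m x / hi) \<le> (1 - e) * h * 1"
        using h e mx m(3) by (intro mult_left_mono) auto
      moreover have "(1 + e) * h / lo * m x = (1 + e) * h * (m x / lo)"
        "(1 - e) * h / hi * m x = (1 - e) * h * (m x / hi)" by simp_all
      ultimately show ?case using b by (simp only: left_diff_distrib[of 1 _ "m x"] mult_1) linarith
    qed
  qed
  then show ?thesis
    using finite_S by (auto simp: eventually_ball_finite_distrib)
qed

section \<open>From dyadic grids to continuous time\<close>

lemma avoid_eq_INT_grid:
  assumes t: "t > 0"
  shows "{\<omega>\<in>space M. \<forall>s\<in>{0..t}. X s \<omega> \<noteq> a} =
     (\<Inter>n. {\<omega>\<in>space M. \<forall>k\<le>(2::nat)^n. X (real k * (t / 2^n)) \<omega> \<noteq> a})"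
proof (intro equalityI subsetI)
  fix \<omega> assume \<omega>: "\<omega> \<in> {\<omega>\<in>space M. \<forall>s\<in>{0..t}. X s \<omega> \<noteq> a}"
  have "real k * (t / 2^n) \<le> t" if "k \<le> 2^n" for k n :: nat
  proof -
    have "real k \<le> 2^n" using that by (metis of_nat_le_iff of_nat_numeral of_nat_power)
    then show ?thesis using t by (simp add: field_simps)
  qed
  with \<omega> t show "\<omega> \<in> (\<Inter>n. {\<omega>\<in>space M. \<forall>k\<le>(2::nat)^n. X (real k * (t / 2^n)) \<omega> \<noteq> a})"
    by auto
next
  fix \<omega> assume \<omega>: "\<omega> \<in> (\<Inter>n. {\<omega>\<in>space M. \<forall>k\<le>(2::nat)^n. X (real k * (t / 2^n)) \<omega> \<noteq> a})"
  then have sp: "\<omega> \<in> space M" by auto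
  have "X s \<omega> \<noteq> a" if s: "s \<in> {0..t}" for s
  proof
    assume eq: "X s \<omega> = a"
    \<comment> \<open>In the discrete topology, right continuity keeps the path at \<open>a\<close>
      on some interval from \<open>s\<close> up to \<open>b\<close>; a grid of mesh below
      \<open>b - s\<close> must have a point in it.\<close>
    have "((\<lambda>s. X s \<omega>) \<longlongrightarrow> a) (at_right s)"
      using right_continuous[OF sp, of s] s eq by (simp add: continuous_within)
    then have "eventually (\<lambda>u. X u \<omega> = a) (at_right s)"
      by (simp add: tendsto_discrete)
    then obtain b where b: "b > s" "\<And>u. s < u \<Longrightarrow> u < b \<Longrightarrow> X u \<omega> = a"
      using eventually_at_right_real[of s] by (auto simp: eventually_at_right_field)
    have "eventually (\<lambda>n. t / 2^n < b - s) sequentially"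
      using b(1) by (intro order_tendstoD(2)[OF LIMSEQ_divide_realpow_zero]) auto
    then obtain n where n: "t / 2^n < b - s" by (auto simp: eventually_sequentially)
    \<comment> \<open>The index of the first grid point at or after \<open>s\<close>. It is at most
      \<open>2^n\<close> even for \<open>s = t\<close>, where the grid point is \<open>t\<close>
      itself.\<close>
    define k where "k = nat \<lceil>s * 2^n / t\<rceil>"
    have nn: "s * 2^n / t \<ge> 0" using s t by auto
    have k1: "s * 2^n / t \<le> real k" unfolding k_def using nn by (simp add: le_of_int_ceiling of_nat_nat)
    have k2: "real k < s * 2^n / t + 1" unfolding k_def using nn
      by (metis ceiling_correct ceiling_mono ceiling_zero diff_less_eq nat_0_le of_int_of_nat_eq)
    have "s * 2^n / t \<le> 2^n" using s t by (simp add: field_simps)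
    then have "\<lceil>s * 2^n / t\<rceil> \<le> 2^n" by (simp add: ceiling_le_iff)
    then have kle: "k \<le> 2^n" unfolding k_def by (simp add: nat_le_iff)
    have "s \<le> real k * (t / 2^n)" using k1 t by (simp add: field_simps)
    moreover have "real k * (t / 2^n) < b"
    proof -
      have "real k * (t / 2^n) < (s * 2^n / t + 1) * (t / 2^n)"
        using k2 t by (intro mult_strict_right_mono) auto
      also have "\<dots> = s + t / 2^n" using t by (simp add: field_simps)
      finally show ?thesis using n by simp
    qed
    ultimately have "X (real k * (t / 2^n)) \<omega> = a"
      using b(2) eq by (cases "s = real k * (t / 2^n)") auto
    then show False using \<omega> kle by auto
  qed
  then show "\<omega> \<in> {\<omega>\<in>space M. \<forall>s\<in>{0..t}. X s \<omega> \<noteq> a}" using sp by auto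
qed

lemma avoid_event: "{\<omega>\<in>space M. \<forall>s\<in>{0..t}. X s \<omega> \<noteq> a} \<in> events"
proof -
  consider "t < 0" | "t = 0" | "t > 0" by linarith
  then show ?thesis
  proof cases
    case 3
    then show ?thesis unfolding avoid_eq_INT_grid[OF 3]
      by (intro sets.countable_INT image_subsetI grid_event) (use 3 in simp_all)
  qed (use X_event[of 0 "-{a}"] in auto)
qed

text \<open>Halving the mesh keeps the old grid points, so the avoidance events decrease, and
  continuity from above applies.\<close>

lemma prob_grid_tendsto:
  assumes t: "t > 0"
  shows "(\<lambda>n. \<P>(\<omega> in M. \<forall>k\<le>(2::nat)^n. X (real k * (t / 2^n)) \<omega> \<noteq> a)) \<longlonglongrightarrow>
     \<P>(\<omega> in M. \<forall>s\<in>{0..t}. X s \<omega> \<noteq> a)"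
  unfolding avoid_eq_INT_grid[OF t]
proof (rule finite_Lim_measure_decseq)
  show "range (\<lambda>n. {\<omega>\<in>space M. \<forall>k\<le>(2::nat)^n. X (real k * (t / 2^n)) \<omega> \<noteq> a}) \<subseteq> events"
    by (intro image_subsetI grid_event) (use t in simp)
  show "decseq (\<lambda>n. {\<omega>\<in>space M. \<forall>k\<le>(2::nat)^n. X (real k * (t / 2^n)) \<omega> \<noteq> a})"
  proof (rule decseq_SucI, rule Collect_mono, intro impI conjI allI)
    fix n \<omega> and k :: nat
    assume *: "\<omega> \<in> space M \<and> (\<forall>k\<le>2 ^ Suc n. X (real k * (t / 2 ^ Suc n)) \<omega> \<noteq> a)" "k \<le> 2 ^ n"
    then have "2 * k \<le> 2 ^ Suc n" by simp
    then have "X (real (2 * k) * (t / 2 ^ Suc n)) \<omega> \<noteq> a" using * by blast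
    then show "X (real k * (t / 2 ^ n)) \<omega> \<noteq> a" by simp
  qed simp
qed

text \<open>If \<open>m\<close> is the mean hitting time, \<open>L m = -1\<close> lies between \<open>- m / lo\<close> and \<open>- m / hi\<close>, so \<open>m\<close> is
  an approximate eigenfunction of the killed semigroup.\<close>

lemma avoid_prob_bounds:
  assumes m: "m a = 0" "\<And>x. x \<in> S - {a} \<Longrightarrow> lo \<le> m x \<and> m x \<le> hi" "lo > 0"
    and gen: "\<And>x. x \<in> S - {a} \<Longrightarrow> (\<Sum>y\<in>S-{x}. q x y * (m y - m x)) = -1"
    and start: "AE \<omega> in M. X 0 \<omega> = x0" "x0 \<in> S - {a}"
    and t: "t \<ge> 0"
  shows "exp (- t / lo) * m x0 / hi \<le> \<P>(\<omega> in M. \<forall>s\<in>{0..t}. X s \<omega> \<noteq> a)" (is "?L \<le> ?p")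
    and "\<P>(\<omega> in M. \<forall>s\<in>{0..t}. X s \<omega> \<noteq> a) \<le> exp (- t / hi) * m x0 / lo" (is "_ \<le> ?U")
proof -
  have mx0: "lo \<le> m x0" "m x0 \<le> hi" "hi > 0" using m start by force+
  have "?L \<le> ?p \<and> ?p \<le> ?U"
  proof (cases "t = 0")
    case True
    have "AE \<omega> in M. X 0 \<omega> \<noteq> a"
      using start(1) by eventually_elim (use start(2) in simp)
    moreover have "{\<omega>\<in>space M. X 0 \<omega> \<noteq> a} \<in> events"
      using X_event[of 0 "-{a}"] by simp
    ultimately have "?p = 1" using True by (simp add: prob_Collect_eq_1)
    then show ?thesis using mx0 m(3) True by simp
  next
    case False
    then have t: "t > 0" using t by simp
    \<comment> \<open>The bounds come first with a slack \<open>e\<close> inherited from the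
      one-step estimates; \<open>e\<close> tends to 0 at the end.\<close>
    have "exp (- (1 + e) * t / lo) * m x0 / hi \<le> ?p \<and> ?p \<le> exp (- (1 - e) * t / hi) * m x0 / lo"
      if e: "e > 0" "e < 1" for e :: real
    proof -
      have h_lim: "(\<lambda>n. t / 2^n) \<longlonglongrightarrow> 0"
        by (rule LIMSEQ_divide_realpow_zero) simp
      have h_right: "filterlim (\<lambda>n. t / 2^n) (at_right 0) sequentially"
        using h_lim t by (intro filterlim_at_withinI) auto
      \<comment> \<open>For small \<open>h\<close> both one-step factors are positive, so their
        powers can be iterated as bounds.\<close>
      have small: "eventually (\<lambda>h. (1 + e) * h / lo < 1 \<and> (1 - e) * h / hi < 1) (at_right 0)"
      proof (intro eventually_conj)
        have "((\<lambda>h. (1 + e) * h / lo) \<longlongrightarrow> (1 + e) * 0 / lo) (at_right 0)"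
          using m(3) by (intro tendsto_intros) auto
        then show "eventually (\<lambda>h. (1 + e) * h / lo < 1) (at_right 0)"
          by (rule order_tendstoD(2)) simp
        have "((\<lambda>h. (1 - e) * h / hi) \<longlongrightarrow> (1 - e) * 0 / hi) (at_right 0)"
          using mx0 by (intro tendsto_intros) auto
        then show "eventually (\<lambda>h. (1 - e) * h / hi < 1) (at_right 0)"
          by (rule order_tendstoD(2)) simp
      qed
      have step: "eventually (\<lambda>h. \<forall>x\<in>S-{a}.
          (1 - (1 + e) * h / lo) * m x \<le> (\<Sum>y\<in>S-{a}. P h x y * m y) \<and>
          (\<Sum>y\<in>S-{a}. P h x y * m y) \<le> (1 - (1 - e) * h / hi) * m x) (at_right 0)"
        by (rule one_step_bounds) (use m gen e in auto)
      have pow: "(\<lambda>n. (1 - c * (t / 2^n)) ^ (2^n)) \<longlonglongrightarrow> exp (- c * t)" for c :: real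
      proof -
        \<comment> \<open>The limit of \<open>(1 + x / n) ^ n\<close> along the subsequence of
          powers of 2.\<close>
        have "(\<lambda>n. (1 + (- c * t) / real (2^n)) ^ (2^n)) \<longlonglongrightarrow> exp (- c * t)"
          by (rule filterlim_compose[OF tendsto_exp_limit_sequentially])
            (rule filterlim_subseq, auto intro: strict_monoI)
        then show ?thesis by (simp add: algebra_simps)
      qed
      have *: "eventually (\<lambda>n.
          (1 - (1 + e) / lo * (t / 2^n)) ^ (2^n) * m x0 / hi
            \<le> \<P>(\<omega> in M. \<forall>k\<le>(2::nat)^n. X (real k * (t / 2^n)) \<omega> \<noteq> a) \<and>
          \<P>(\<omega> in M. \<forall>k\<le>(2::nat)^n. X (real k * (t / 2^n)) \<omega> \<noteq> a)
            \<le> (1 - (1 - e) / hi * (t / 2^n)) ^ (2^n) * m x0 / lo) sequentially"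
        using eventually_compose_filterlim[OF small h_right]
          eventually_compose_filterlim[OF step h_right]
      proof eventually_elim
        case (elim n)
        let ?h = "t / 2^n"
        have h: "?h \<ge> 0" using t by simp
        have E0: "killed_expectation a ?h m 0 = m x0" by (rule killed_expectation_0[OF start])
        have up: "killed_expectation a ?h m (2^n) \<le> (1 - (1 - e) * ?h / hi) ^ (2^n) * m x0"
          unfolding E0[symmetric] by (rule killed_expectation_le) (use elim h in auto)
        have down: "(1 - (1 + e) * ?h / lo) ^ (2^n) * m x0 \<le> killed_expectation a ?h m (2^n)"
          unfolding E0[symmetric] by (rule killed_expectation_ge) (use elim h in auto)
        \<comment> \<open>Replacing \<open>m\<close> by its bounds \<open>hi\<close> and
          \<open>lo\<close> turns the killed expectation into the survival probability on the grid:
          \<open>hi\<close> serves the lower bound on that probability, \<open>lo\<close> the upper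
          one.\<close>
        have "killed_expectation a ?h m (2^n) \<le> (\<Sum>x\<in>S-{a}. killed_law a ?h (2^n) x * hi)"
          unfolding killed_expectation_def
          by (intro sum_mono mult_left_mono killed_law_nonneg) (use m(2) in auto)
        then have 1: "killed_expectation a ?h m (2^n) \<le>
            \<P>(\<omega> in M. \<forall>k\<le>(2::nat)^n. X (real k * ?h) \<omega> \<noteq> a) * hi"
          by (simp only: prob_grid[OF h] sum_distrib_right)
        have "(\<Sum>x\<in>S-{a}. killed_law a ?h (2^n) x * lo) \<le> killed_expectation a ?h m (2^n)"
          unfolding killed_expectation_def
          by (intro sum_mono mult_left_mono killed_law_nonneg) (use m(2) in auto)
        then have 2: "\<P>(\<omega> in M. \<forall>k\<le>(2::nat)^n. X (real k * ?h) \<omega> \<noteq> a) * lo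
            \<le> killed_expectation a ?h m (2^n)"
          by (simp only: prob_grid[OF h] sum_distrib_right)
        show ?case
          using order_trans[OF down 1] order_trans[OF 2 up] m(3) mx0
          by (simp add: pos_le_divide_eq pos_divide_le_eq mult_ac)
      qed
      have "exp (- ((1 + e) / lo) * t) * m x0 / hi \<le> ?p"
        by (rule tendsto_le[OF _ prob_grid_tendsto[OF t] tendsto_divide[OF
            tendsto_mult[OF pow tendsto_const] tendsto_const]])
          (use mx0 in \<open>auto intro!: eventually_mono[OF *]\<close>)
      moreover have "?p \<le> exp (- ((1 - e) / hi) * t) * m x0 / lo"
        by (rule tendsto_le[OF _ tendsto_divide[OF
            tendsto_mult[OF pow tendsto_const] tendsto_const] prob_grid_tendsto[OF t]])
          (use m(3) in \<open>auto intro!: eventually_mono[OF *]\<close>)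
      ultimately show ?thesis by (simp only: minus_mult_minus times_divide_eq_left mult_minus_left minus_divide_left)
    qed
    then have ev: "eventually (\<lambda>e. exp (- (1 + e) * t / lo) * m x0 / hi \<le> ?p \<and>
        ?p \<le> exp (- (1 - e) * t / hi) * m x0 / lo) (at_right 0)"
      using eventually_at_right_real[of 0 "1::real"] by (auto elim!: eventually_mono)
    have "((\<lambda>e. exp (- (1 + e) * t / lo) * m x0 / hi) \<longlongrightarrow> exp (- (1 + 0) * t / lo) * m x0 / hi) (at_right 0)"
      using m(3) mx0 by (intro tendsto_intros) auto
    moreover have "((\<lambda>e. exp (- (1 - e) * t / hi) * m x0 / lo) \<longlongrightarrow> exp (- (1 - 0) * t / hi) * m x0 / lo) (at_right 0)"
      using m(3) mx0 by (intro tendsto_intros) auto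
    ultimately show ?thesis
      using tendsto_upperbound[OF _ eventually_mono[OF ev], of _ ?L]
        tendsto_lowerbound[OF _ eventually_mono[OF ev], of _ ?U] by auto
  qed
  then show "?L \<le> ?p" "?p \<le> ?U" by auto
qed

section \<open>The hitting time as a random variable\<close>

text \<open>By right continuity, not hitting \<open>a\<close> up to and including \<open>t\<close> means not hitting it a bit longer, so
  that the infimum cannot equal \<open>t\<close>.\<close>

lemma hitting_time_le_iff:
  assumes \<omega>: "\<omega> \<in> space M" and t: "t \<ge> 0"
  shows "hitting_time X a \<omega> \<le> ennreal t \<longleftrightarrow> (\<exists>s\<in>{0..t}. X s \<omega> = a)"
proof
  assume "\<exists>s\<in>{0..t}. X s \<omega> = a"
  then obtain s where s: "s \<in> {0..t}" "X s \<omega> = a" by blast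
  then show "hitting_time X a \<omega> \<le> ennreal t"
    unfolding hitting_time_def by (intro INF_lower2[of s]) (auto intro: ennreal_leI)
next
  assume le: "hitting_time X a \<omega> \<le> ennreal t"
  show "\<exists>s\<in>{0..t}. X s \<omega> = a"
  proof (rule ccontr)
    assume no: "\<not> ?thesis"
    have "((\<lambda>s. X s \<omega>) \<longlongrightarrow> X t \<omega>) (at_right t)"
      using right_continuous[OF \<omega> t] by (simp add: continuous_within)
    then have "eventually (\<lambda>u. X u \<omega> = X t \<omega>) (at_right t)"
      by (simp add: tendsto_discrete)
    then obtain b where b: "b > t" "\<And>u. t < u \<Longrightarrow> u < b \<Longrightarrow> X u \<omega> = X t \<omega>"
      by (auto simp: eventually_at_right_field)
    have "b \<le> s" if "0 \<le> s" "X s \<omega> = a" for s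
    proof (rule ccontr)
      assume "\<not> b \<le> s"
      then show False using no that b(2)[of s] t by (cases "s \<le> t") force+
    qed
    then have "ennreal b \<le> hitting_time X a \<omega>"
      unfolding hitting_time_def by (intro INF_greatest ennreal_leI) auto
    then have "ennreal b \<le> ennreal t" using le by (rule order_trans)
    then show False using b(1) t by (simp add: ennreal_le_iff)
  qed
qed

lemma measurable_hitting_time: "hitting_time X a \<in> borel_measurable M"
proof (rule borel_measurableI_le)
  fix y :: ennreal
  show "{\<omega>\<in>space M. hitting_time X a \<omega> \<le> y} \<in> events"
  proof (cases y)
    case (real t)
    then have "{\<omega>\<in>space M. hitting_time X a \<omega> \<le> y} = space M - {\<omega>\<in>space M. \<forall>s\<in>{0..t}. X s \<omega> \<noteq> a}"
      unfolding real(2) using hitting_time_le_iff[OF _ real(1)] by blast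
    then show ?thesis using avoid_event by auto
  qed simp
qed

text \<open>The limit assumption says that the hitting time is almost surely finite, so the junk value
  \<open>enn2real \<infinity> = 0\<close> does not contribute.\<close>

lemma prob_hitting_time_le:
  assumes t: "t \<ge> 0"
    and lim: "((\<lambda>t. \<P>(\<omega> in M. \<forall>s\<in>{0..t}. X s \<omega> \<noteq> a)) \<longlongrightarrow> 0) at_top"
  shows "\<P>(\<omega> in M. enn2real (hitting_time X a \<omega>) \<le> t) = 1 - \<P>(\<omega> in M. \<forall>s\<in>{0..t}. X s \<omega> \<noteq> a)"
proof -
  note [measurable] = measurable_hitting_time
  \<comment> \<open>A path with infinite hitting time avoids \<open>a\<close> up to every
    \<open>u\<close>; letting \<open>u\<close> grow makes this event null.\<close>
  have "\<P>(\<omega> in M. hitting_time X a \<omega> = \<infinity>) \<le> \<P>(\<omega> in M. \<forall>s\<in>{0..u}. X s \<omega> \<noteq> a)" if u: "u \<ge> 0" for u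
  proof (rule finite_measure_mono[OF _ avoid_event], rule Collect_mono, rule impI)
    fix \<omega> assume "\<omega> \<in> space M \<and> hitting_time X a \<omega> = \<infinity>"
    then show "\<omega> \<in> space M \<and> (\<forall>s\<in>{0..u}. X s \<omega> \<noteq> a)"
      using hitting_time_le_iff[OF _ u, of \<omega> a] by (auto simp: top_unique)
  qed
  then have "\<P>(\<omega> in M. hitting_time X a \<omega> = \<infinity>) \<le> 0"
    by (intro tendsto_lowerbound[OF lim]) (auto intro!: eventually_mono[OF eventually_ge_at_top[of 0]])
  then have "\<P>(\<omega> in M. hitting_time X a \<omega> = \<infinity>) = 0"
    by (simp add: antisym)
  then have fin: "AE \<omega> in M. hitting_time X a \<omega> \<noteq> \<infinity>"
    by (subst (asm) prob_eq_0) auto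
  have iff: "enn2real (hitting_time X a \<omega>) \<le> t \<longleftrightarrow> \<not> (\<forall>s\<in>{0..t}. X s \<omega> \<noteq> a)"
    if "\<omega> \<in> space M" "hitting_time X a \<omega> \<noteq> \<infinity>" for \<omega>
    using hitting_time_le_iff[OF that(1) t, of a] that(2) t
    by (cases "hitting_time X a \<omega>") (auto simp: ennreal_le_iff)
  have "\<P>(\<omega> in M. enn2real (hitting_time X a \<omega>) \<le> t) = \<P>(\<omega> in M. \<not> (\<forall>s\<in>{0..t}. X s \<omega> \<noteq> a))"
  proof (rule prob_eq_AE)
    show "AE \<omega> in M. (enn2real (hitting_time X a \<omega>) \<le> t) = (\<not> (\<forall>s\<in>{0..t}. X s \<omega> \<noteq> a))"
      using fin AE_space by eventually_elim (rule iff)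
    show "{\<omega>\<in>space M. enn2real (hitting_time X a \<omega>) \<le> t} \<in> events" by measurable
    show "{\<omega>\<in>space M. \<not> (\<forall>s\<in>{0..t}. X s \<omega> \<noteq> a)} \<in> events"
      using avoid_event by (rule sets.sets_Collect_neg)
  qed
  also have "\<dots> = 1 - \<P>(\<omega> in M. \<forall>s\<in>{0..t}. X s \<omega> \<noteq> a)"
    using avoid_event by (rule prob_neg)
  finally show ?thesis .
qed

end

text \<open>The exponential density is the Erlang density with shape 0.\<close>

lemma cdf_exponential:
  assumes "0 < l"
  shows "cdf (density lborel (exponential_density l)) x = (if x < 0 then 0 else 1 - exp (- l * x))"
proof -
  have "x \<ge> 0 \<Longrightarrow> exp (- (l * x)) \<le> 1" using assms by simp
  then show ?thesis
    using emeasure_erlang_density[OF assms, of 0 x]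
    by (auto simp: cdf_def2 measure_def erlang_CDF_def)
qed

section \<open>Mean hitting times of the Engset process\<close>

text \<open>The mean time from \<open>x\<close> to \<open>x - 1\<close>: binomial weights satisfy detailed balance, so it is the
  stationary mass of \<open>{x..C}\<close> divided by the stationary flow from \<open>x\<close> to \<open>x - 1\<close>.\<close>

definition engset_increment :: "nat \<Rightarrow> nat \<Rightarrow> real \<Rightarrow> nat \<Rightarrow> real" where
  "engset_increment N C \<nu> x = (\<Sum>y=x..C. Bernstein N y \<nu>) / ((1 - \<nu>) * real x * Bernstein N x \<nu>)"

text \<open>Downward jumps have size 1, so a path from \<open>x\<close> to 0 visits every level in
  between, and the mean times of the one-level descents add up.\<close>

definition engset_mean :: "nat \<Rightarrow> nat \<Rightarrow> real \<Rightarrow> nat \<Rightarrow> real" where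
  "engset_mean N C \<nu> x = (\<Sum>k=1..x. engset_increment N C \<nu> k)"

section \<open>Detailed balance and the equation for the mean\<close>

lemma Bernstein_detailed_balance:
  assumes "x < N"
  shows "Bernstein N (Suc x) \<nu> * ((1 - \<nu>) * real (Suc x)) = Bernstein N x \<nu> * (\<nu> * (real N - real x))"
proof -
  have "Suc x * (N choose Suc x) = (N - x) * (N choose x)"
    by (metis binomial_absorb_comp binomial_absorption mult.commute)
  then have c: "real (Suc x) * real (N choose Suc x) = (real N - real x) * real (N choose x)"
    using assms by (metis of_nat_diff of_nat_mult less_imp_le)
  have "N - x = Suc (N - Suc x)" using assms by simp
  then have "Bernstein N x \<nu> * (\<nu> * (real N - real x)) =
     ((real N - real x) * real (N choose x)) * (\<nu> ^ Suc x * (1 - \<nu>) ^ (N - Suc x) * (1 - \<nu>))"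
    by (simp add: Bernstein_def mult_ac)
  also have "\<dots> = Bernstein N (Suc x) \<nu> * ((1 - \<nu>) * real (Suc x))"
    unfolding c[symmetric] by (simp add: Bernstein_def mult_ac)
  finally show ?thesis by simp
qed

lemma engset_increment_nonneg:
  assumes "0 < \<nu>" "\<nu> < 1"
  shows "0 \<le> engset_increment N C \<nu> x"
  unfolding engset_increment_def using assms
  by (intro divide_nonneg_nonneg sum_nonneg mult_nonneg_nonneg Bernstein_nonneg) auto

text \<open>This is first-step analysis for a one-level descent: after a jump up, two levels have to
  be descended. Algebraically, the first term of the tail sum is split off and detailed balance
  rewrites the rest.\<close>

lemma engset_increment_rec:
  assumes "0 < \<nu>" "\<nu> < 1" "1 \<le> x" "x \<le> C" "C \<le> N"
  shows "(1 - \<nu>) * real x * engset_increment N C \<nu> x =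
     1 + (if x < C then \<nu> * (real N - real x) * engset_increment N C \<nu> (Suc x) else 0)"
proof -
  have pos: "Bernstein N x \<nu> > 0" using assms by (intro Bernstein_pos) auto
  have L: "(1 - \<nu>) * real x * engset_increment N C \<nu> x = (\<Sum>y=x..C. Bernstein N y \<nu>) / Bernstein N x \<nu>"
    using assms pos by (simp add: engset_increment_def)
  also have "(\<Sum>y=x..C. Bernstein N y \<nu>) = Bernstein N x \<nu> + (\<Sum>y=Suc x..C. Bernstein N y \<nu>)"
    using assms by (simp add: sum.atLeast_Suc_atMost)
  also have "\<dots> / Bernstein N x \<nu> = 1 + (\<Sum>y=Suc x..C. Bernstein N y \<nu>) / Bernstein N x \<nu>"
    using pos by (simp add: add_divide_distrib)
  also have "(\<Sum>y=Suc x..C. Bernstein N y \<nu>) / Bernstein N x \<nu> =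
      (if x < C then \<nu> * (real N - real x) * engset_increment N C \<nu> (Suc x) else 0)"
  proof (cases "x < C")
    case True
    then have xN: "x < N" using assms by simp
    have bal: "(1 - \<nu>) * real (Suc x) * Bernstein N (Suc x) \<nu> = Bernstein N x \<nu> * (\<nu> * (real N - real x))"
      using Bernstein_detailed_balance[OF xN] by (simp only: mult_ac)
    have "\<nu> * (real N - real x) \<noteq> 0" using xN assms by simp
    then show ?thesis using True pos
      unfolding engset_increment_def bal by (simp add: divide_simps)
  qed (use assms in auto)
  finally show ?thesis .
qed

lemma engset_mean_Suc: "engset_mean N C \<nu> (Suc x) = engset_mean N C \<nu> x + engset_increment N C \<nu> (Suc x)"
  by (simp add: engset_mean_def)

text \<open>Only the two neighbours of \<open>x\<close> contribute, and the differences of the mean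
  there are increments, so the claim becomes \<open>engset_increment_rec\<close>.\<close>

lemma engset_mean_generator:
  assumes "0 < \<nu>" "\<nu> < 1" "1 \<le> C" "C \<le> N" "x \<in> {0..C} - {0}"
  shows "(\<Sum>y\<in>{0..C}-{x}. engset_rate N C \<nu> (1 - \<nu>) x y * (engset_mean N C \<nu> y - engset_mean N C \<nu> x)) = -1"
proof -
  let ?m = "engset_mean N C \<nu>" and ?d = "engset_increment N C \<nu>"
  obtain z where z: "x = Suc z" using assms(5) by (cases x) auto
  have "(\<Sum>y\<in>{0..C}-{x}. engset_rate N C \<nu> (1 - \<nu>) x y * (?m y - ?m x)) =
     (\<Sum>y\<in>{0..C}. (if y = z then (1 - \<nu>) * real x * (?m z - ?m x) else 0) +
        (if y = Suc x then (if x < C then \<nu> * (real N - real x) * (?m (Suc x) - ?m x) else 0) else 0))"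
    using assms(5) z by (intro sum.mono_neutral_cong_left) (auto simp: engset_rate_def)
  also have "\<dots> = (1 - \<nu>) * real x * (?m z - ?m x)
      + (if x < C then \<nu> * (real N - real x) * (?m (Suc x) - ?m x) else 0)"
    using assms(5) z by (simp add: sum.distrib)
  also have "\<dots> = - ((1 - \<nu>) * real x * ?d x) + (if x < C then \<nu> * (real N - real x) * ?d (Suc x) else 0)"
    by (simp add: z engset_mean_Suc)
  also have "\<dots> = -1"
    using assms by (subst engset_increment_rec) auto
  finally show ?thesis .
qed

lemma engset_mean_mono:
  assumes "0 < \<nu>" "\<nu> < 1" "x \<le> y"
  shows "engset_mean N C \<nu> x \<le> engset_mean N C \<nu> y"
  unfolding engset_mean_def using assms
  by (intro sum_mono2) (auto intro!: engset_increment_nonneg)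

text \<open>The source of the normalization: \<open>Bernstein N 1 \<nu>\<close> equals
  \<open>N * \<nu> * (1 - \<nu>) ^ (N - 1)\<close>, so the prefactor cancels everything but the
  weight of \<open>{1..C}\<close> and \<open>1 / \<nu>\<close>.\<close>

lemma engset_mean_1:
  assumes "0 < \<nu>" "\<nu> < 1" "1 \<le> N"
  shows "real N * (1 - \<nu>) ^ N * engset_mean N C \<nu> 1 = (\<Sum>y=1..C. Bernstein N y \<nu>) / \<nu>"
proof -
  obtain n where n: "N = Suc n" using assms by (cases N) auto
  show ?thesis using assms
    by (simp add: engset_mean_def engset_increment_def Bernstein_def n)
qed

lemma engset_mean_1_pos:
  assumes "0 < \<nu>" "\<nu> < 1" "1 \<le> C" "C \<le> N"
  shows "0 < engset_mean N C \<nu> 1"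
  using assms
  by (auto simp: engset_mean_def engset_increment_def intro!: divide_pos_pos sum_pos mult_pos_pos Bernstein_pos)

section \<open>Estimates for the one-level descents\<close>

lemma engset_increment_Suc_le:
  assumes "0 < \<nu>" "\<nu> < 1" "1 \<le> x" "x < C" "C \<le> N"
  shows "engset_increment N C \<nu> (Suc x) \<le>
     (1 - \<nu>) * real x / (\<nu> * (real N - real x)) * engset_increment N C \<nu> x"
proof -
  \<comment> \<open>The summand 1 of the recursion is dropped. The resulting ratio is of order
    \<open>1 / N\<close> for fixed \<open>x\<close>.\<close>
  have "\<nu> * (real N - real x) * engset_increment N C \<nu> (Suc x) \<le> (1 - \<nu>) * real x * engset_increment N C \<nu> x"
    using engset_increment_rec[of \<nu> x C N] assms by simp
  moreover have "\<nu> * (real N - real x) > 0" using assms by simp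
  ultimately show ?thesis by (simp add: field_simps)
qed

text \<open>Above \<open>\<nu> N + 1\<close>, the drift is at most \<open>-1\<close>, so going down one level takes mean time at most \<open>1\<close>.\<close>

lemma engset_increment_le_1:
  assumes "0 < \<nu>" "\<nu> < 1" "\<nu> * real N + 1 \<le> real x" "1 \<le> x" "x \<le> C" "C \<le> N"
  shows "engset_increment N C \<nu> x \<le> 1"
  using assms(5,3,4)
proof (induction x rule: inc_induct)
  \<comment> \<open>The condition on \<open>x\<close> says
    \<open>1 + \<nu> * (N - x) \<le> (1 - \<nu>) * x\<close>. The induction runs downwards from
    \<open>C\<close>, where the recursion has no upward term.\<close>
  have le: "engset_increment N C \<nu> x \<le> 1"
    if "(1 - \<nu>) * real x * engset_increment N C \<nu> x \<le> 1 + \<nu> * (real N - real x)"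
      "\<nu> * real N + 1 \<le> real x" "1 \<le> x" for x
  proof -
    have "(1 - \<nu>) * real x * engset_increment N C \<nu> x \<le> (1 - \<nu>) * real x * 1"
      using that by (simp add: algebra_simps)
    then show ?thesis using that assms by (subst (asm) mult_le_cancel_left_pos) auto
  qed
  {
    case base
    have "0 \<le> \<nu> * (real N - real C)" using assms by simp
    then show ?case using base assms engset_increment_rec[of \<nu> C C N] by (intro le) auto
  next
    case (step x)
    have "engset_increment N C \<nu> (Suc x) \<le> 1" using step by simp
    then have "\<nu> * (real N - real x) * engset_increment N C \<nu> (Suc x) \<le> \<nu> * (real N - real x) * 1"
      using step assms by (intro mult_left_mono) auto
    then show ?case using step assms engset_increment_rec[of \<nu> x C N] by (intro le) auto
  }
qed

text \<open>While \<open>x \<le> \<nu> * N\<close> the ratio of successive increments is at most 1,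
  so they do not increase; once \<open>x\<close> exceeds \<open>\<nu> * N\<close>, level
  \<open>Suc x\<close> is in the range of \<open>engset_increment_le_1\<close>.\<close>

lemma engset_increment_le:
  assumes "0 < \<nu>" "\<nu> < 1" "3 \<le> x" "x \<le> C" "C \<le> N"
  shows "engset_increment N C \<nu> x \<le> engset_increment N C \<nu> 3 + 1"
  using assms(3,4)
proof (induction x rule: dec_induct)
  case (step x)
  show ?case
  proof (cases "real x \<le> \<nu> * real N")
    case True
    have "(1 - \<nu>) * real x / (\<nu> * (real N - real x)) \<le> 1"
      using True step assms by (simp add: pos_divide_le_eq algebra_simps)
    then have "(1 - \<nu>) * real x / (\<nu> * (real N - real x)) * engset_increment N C \<nu> x
        \<le> 1 * engset_increment N C \<nu> x"
      using assms by (intro mult_right_mono engset_increment_nonneg) auto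
    then show ?thesis
      using engset_increment_Suc_le[of \<nu> x C N] step assms by simp
  next
    case False
    then have "engset_increment N C \<nu> (Suc x) \<le> 1"
      using step assms by (intro engset_increment_le_1) auto
    then show ?thesis using engset_increment_nonneg[of \<nu> N C 3] assms by simp
  qed
qed simp

text \<open>Two ratios of order \<open>1 / N\<close> separate the increment at 3 from that at 1, so
  even \<open>N\<close> copies of it are negligible relative to the latter. Starting from level 2
  would leave a contribution of the same order as the main term. The final \<open>real N\<close>
  collects the extra 1 per level.\<close>

lemma engset_mean_le:
  assumes "0 < \<nu>" "\<nu> < 1" "3 \<le> C" "C \<le> N"
  shows "engset_mean N C \<nu> C \<le> engset_mean N C \<nu> 1 *
     (1 + (1 - \<nu>) / (\<nu> * (real N - 1)) +
       real N * (2 * (1 - \<nu>) / (\<nu> * (real N - 2)) * ((1 - \<nu>) / (\<nu> * (real N - 1))))) + real N"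
proof -
  let ?d = "engset_increment N C \<nu>"
  define r1 r2 where "r1 = (1 - \<nu>) / (\<nu> * (real N - 1))" and "r2 = 2 * (1 - \<nu>) / (\<nu> * (real N - 2))"
  have r: "r1 \<ge> 0" "r2 \<ge> 0" using assms by (auto simp: r1_def r2_def)
  have d2: "?d 2 \<le> r1 * ?d 1"
    using engset_increment_Suc_le[of \<nu> 1 C N] assms by (simp add: r1_def numeral_2_eq_2)
  have d3: "?d 3 \<le> r2 * ?d 2"
    using engset_increment_Suc_le[of \<nu> 2 C N] assms by (simp add: r2_def mult.commute)
  have d3': "?d 3 \<le> r2 * (r1 * ?d 1)"
    using d3 mult_left_mono[OF d2 r(2)] by linarith
  have "engset_mean N C \<nu> C = ?d 1 + ?d 2 + (\<Sum>k=3..C. ?d k)"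
    using assms by (simp add: engset_mean_def sum.atLeast_Suc_atMost numeral_2_eq_2 numeral_3_eq_3)
  also have "(\<Sum>k=3..C. ?d k) \<le> (\<Sum>k=3..C. ?d 3 + 1)"
    using assms by (intro sum_mono engset_increment_le) auto
  also have "\<dots> \<le> real N * (?d 3 + 1)"
    using assms engset_increment_nonneg[of \<nu> N C 3] by (simp add: mult_right_mono)
  also have "\<dots> \<le> real N * (r2 * (r1 * ?d 1) + 1)"
    using d3' by (intro mult_left_mono) auto
  finally have "engset_mean N C \<nu> C \<le> ?d 1 * (1 + r1 + real N * (r2 * r1)) + real N"
    using d2 by (simp add: algebra_simps)
  then show ?thesis by (simp add: r1_def r2_def engset_mean_def)
qed

section \<open>Concentration of the binomial weights\<close>

lemma Bernstein_variance:
  "(\<Sum>k\<le>N. (real k - real N * \<nu>)\<^sup>2 * Bernstein N k \<nu>) = real N * \<nu> * (1 - \<nu>)"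
proof -
  \<comment> \<open>The square is expanded in \<open>k * (k - 1)\<close>, \<open>k\<close> and 1,
    whose Bernstein sums are known.\<close>
  have "(\<Sum>k\<le>N. (real k - real N * \<nu>)\<^sup>2 * Bernstein N k \<nu>) =
     (\<Sum>k\<le>N. real k * (real k - 1) * Bernstein N k \<nu> + (1 - 2 * real N * \<nu>) * (real k * Bernstein N k \<nu>)
        + (real N * \<nu>)\<^sup>2 * Bernstein N k \<nu>)"
    by (intro sum.cong) (simp_all add: algebra_simps power2_eq_square)
  also have "\<dots> = real N * (real N - 1) * \<nu>\<^sup>2 + (1 - 2 * real N * \<nu>) * (real N * \<nu>) + (real N * \<nu>)\<^sup>2"
    by (simp add: sum.distrib sum_distrib_left[symmetric])
  also have "\<dots> = real N * \<nu> * (1 - \<nu>)"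
    by (simp add: algebra_simps power2_eq_square)
  finally show ?thesis .
qed

text \<open>What is missing from total mass 1 is the atom at 0 and the tail above \<open>C\<close>.
  The tail lies at distance at least \<open>\<delta> * N\<close> above the mean
  \<open>N * \<nu>\<close>, so Chebyshev's inequality bounds it.\<close>

lemma Bernstein_sum_ge:
  assumes "0 < \<nu>" "\<nu> < 1" "real C \<ge> \<nu> * real N + \<delta> * real N" "\<delta> > 0" "C \<le> N" "1 \<le> N"
  shows "(\<Sum>y=1..C. Bernstein N y \<nu>) \<ge> 1 - (1 - \<nu>) ^ N - \<nu> * (1 - \<nu>) / (\<delta>\<^sup>2 * real N)"
proof -
  have B: "Bernstein N k \<nu> \<ge> 0" for k using assms by (intro Bernstein_nonneg) auto
  have "(\<Sum>y\<in>{C<..N}. (\<delta> * real N)\<^sup>2 * Bernstein N y \<nu>) \<le> (\<Sum>y\<in>{C<..N}. (real y - real N * \<nu>)\<^sup>2 * Bernstein N y \<nu>)"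
    using assms by (intro sum_mono mult_right_mono power_mono B) (auto simp: algebra_simps)
  also have "\<dots> \<le> (\<Sum>k\<le>N. (real k - real N * \<nu>)\<^sup>2 * Bernstein N k \<nu>)"
    by (intro sum_mono2) (auto intro!: mult_nonneg_nonneg B)
  finally have "(\<delta> * real N)\<^sup>2 * (\<Sum>y\<in>{C<..N}. Bernstein N y \<nu>) \<le> real N * \<nu> * (1 - \<nu>)"
    by (simp add: Bernstein_variance sum_distrib_left)
  then have tail: "(\<Sum>y\<in>{C<..N}. Bernstein N y \<nu>) \<le> \<nu> * (1 - \<nu>) / (\<delta>\<^sup>2 * real N)"
  proof -
    assume "(\<delta> * real N)\<^sup>2 * (\<Sum>y\<in>{C<..N}. Bernstein N y \<nu>) \<le> real N * \<nu> * (1 - \<nu>)"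
    then have "real N * (\<delta>\<^sup>2 * real N * (\<Sum>y\<in>{C<..N}. Bernstein N y \<nu>)) \<le> real N * (\<nu> * (1 - \<nu>))"
      by (simp add: power2_eq_square mult_ac)
    then show ?thesis using assms by (simp add: pos_le_divide_eq mult_ac)
  qed
  have "1 = (\<Sum>k\<in>{0} \<union> {1..C} \<union> {C<..N}. Bernstein N k \<nu>)"
    using assms by (subst sum_Bernstein[of N \<nu>, symmetric], intro sum.cong) auto
  also have "\<dots> = Bernstein N 0 \<nu> + (\<Sum>y=1..C. Bernstein N y \<nu>) + (\<Sum>y\<in>{C<..N}. Bernstein N y \<nu>)"
    by (subst sum.union_disjoint; force)+
  also have "Bernstein N 0 \<nu> = (1 - \<nu>) ^ N" by (simp add: Bernstein_def)
  finally show ?thesis using tail by simp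
qed

lemma Bernstein_sum_le_1:
  assumes "0 < \<nu>" "\<nu> < 1" "C \<le> N"
  shows "(\<Sum>y=1..C. Bernstein N y \<nu>) \<le> 1"
  unfolding sum_Bernstein[of N \<nu>, symmetric]
  using assms by (intro sum_mono2) (auto intro: Bernstein_nonneg)

section \<open>Limits of the normalized means\<close>

lemma engset_mean_1_tendsto:
  assumes \<nu>: "0 < \<nu>" "\<nu> < 1" and "\<delta> > 0"
    and C: "eventually (\<lambda>N. real (C N) \<ge> \<nu> * real N + \<delta> * real N \<and> C N \<le> N) sequentially"
  shows "(\<lambda>N. real N * (1 - \<nu>) ^ N * engset_mean N (C N) \<nu> 1) \<longlonglongrightarrow> 1 / \<nu>"
proof (rule tendsto_sandwich)
  show "eventually (\<lambda>N. (1 - (1 - \<nu>) ^ N - \<nu> * (1 - \<nu>) / (\<delta>\<^sup>2 * real N)) / \<nu>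
      \<le> real N * (1 - \<nu>) ^ N * engset_mean N (C N) \<nu> 1) sequentially"
    using C eventually_ge_at_top[of 1]
    by eventually_elim
      (use assms in \<open>simp only: engset_mean_1, intro divide_right_mono Bernstein_sum_ge, auto\<close>)
  show "eventually (\<lambda>N. real N * (1 - \<nu>) ^ N * engset_mean N (C N) \<nu> 1 \<le> 1 / \<nu>) sequentially"
    using C eventually_ge_at_top[of 1]
    by eventually_elim
      (use assms in \<open>simp only: engset_mean_1, intro divide_right_mono Bernstein_sum_le_1, auto\<close>)
  have "(\<lambda>N. \<nu> * (1 - \<nu>) / (\<delta>\<^sup>2 * real N)) \<longlonglongrightarrow> 0"
    using assms by real_asymp
  then have "(\<lambda>N. (1 - (1 - \<nu>) ^ N - \<nu> * (1 - \<nu>) / (\<delta>\<^sup>2 * real N)) / \<nu>) \<longlonglongrightarrow> (1 - 0 - 0) / \<nu>"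
    using \<nu> by (intro tendsto_intros LIMSEQ_power_zero) auto
  then show "(\<lambda>N. (1 - (1 - \<nu>) ^ N - \<nu> * (1 - \<nu>) / (\<delta>\<^sup>2 * real N)) / \<nu>) \<longlonglongrightarrow> 1 / \<nu>" by simp
qed simp

text \<open>The mean from the top lies between the mean from 1 and the bound of
  \<open>engset_mean_le\<close>, whose factor \<open>f N\<close> tends to 1; its additive
  \<open>N\<close> is killed by the exponentially small \<open>N * (1 - \<nu>) ^ N\<close>.\<close>

lemma engset_mean_top_tendsto:
  assumes \<nu>: "0 < \<nu>" "\<nu> < 1" and \<delta>: "\<delta> > 0"
    and C: "eventually (\<lambda>N. real (C N) \<ge> \<nu> * real N + \<delta> * real N \<and> C N \<le> N) sequentially"
  shows "(\<lambda>N. real N * (1 - \<nu>) ^ N * engset_mean N (C N) \<nu> (C N)) \<longlonglongrightarrow> 1 / \<nu>"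
proof (rule tendsto_sandwich)
  define f where "f N = 1 + (1 - \<nu>) / (\<nu> * (real N - 1)) +
       real N * (2 * (1 - \<nu>) / (\<nu> * (real N - 2)) * ((1 - \<nu>) / (\<nu> * (real N - 1))))" for N
  let ?a = "\<lambda>N. real N * (1 - \<nu>) ^ N"
  have C3: "eventually (\<lambda>N. C N \<ge> 3) sequentially"
  proof -
    have "filterlim (\<lambda>N. \<delta> * real N) at_top sequentially" using \<delta> by real_asymp
    then have "eventually (\<lambda>N. \<delta> * real N \<ge> 3) sequentially" by (simp add: filterlim_at_top)
    with C show ?thesis
    proof eventually_elim
      case (elim N)
      moreover have "\<nu> * real N \<ge> 0" using \<nu> by simp
      ultimately have "real (C N) \<ge> 3" by linarith
      then show ?case by simp
    qed
  qed
  show "eventually (\<lambda>N. ?a N * engset_mean N (C N) \<nu> 1 \<le> ?a N * engset_mean N (C N) \<nu> (C N)) sequentially"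
    using C3 by eventually_elim (use \<nu> in \<open>intro mult_left_mono engset_mean_mono, auto\<close>)
  show "eventually (\<lambda>N. ?a N * engset_mean N (C N) \<nu> (C N) \<le>
      ?a N * engset_mean N (C N) \<nu> 1 * f N + ?a N * real N) sequentially"
    using C C3
  proof eventually_elim
    case (elim N)
    have "engset_mean N (C N) \<nu> (C N) \<le> engset_mean N (C N) \<nu> 1 * f N + real N"
      unfolding f_def using elim \<nu> by (intro engset_mean_le) auto
    then have "?a N * engset_mean N (C N) \<nu> (C N) \<le> ?a N * (engset_mean N (C N) \<nu> 1 * f N + real N)"
      using \<nu> by (intro mult_left_mono) auto
    then show ?case by (simp add: algebra_simps)
  qed
  show lim1: "(\<lambda>N. ?a N * engset_mean N (C N) \<nu> 1) \<longlonglongrightarrow> 1 / \<nu>"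
    by (rule engset_mean_1_tendsto[OF \<nu> \<delta> C])
  have "f \<longlonglongrightarrow> 1" unfolding f_def using \<nu> by real_asymp
  moreover have "(\<lambda>N. ?a N * real N) \<longlonglongrightarrow> 0" using \<nu> by real_asymp
  ultimately have "(\<lambda>N. ?a N * engset_mean N (C N) \<nu> 1 * f N + ?a N * real N) \<longlonglongrightarrow> 1 / \<nu> * 1 + 0"
    by (intro tendsto_intros lim1)
  then show "(\<lambda>N. ?a N * engset_mean N (C N) \<nu> 1 * f N + ?a N * real N) \<longlonglongrightarrow> 1 / \<nu>" by simp
qed

section \<open>Convergence to the exponential law\<close>

text \<open>The general bounds with \<open>lo\<close> and \<open>hi\<close> the means from 1 and
  from \<open>C\<close>, between which the monotone mean stays. Starting at the top gives
  \<open>m x0 = hi\<close>, so the lower bound has no prefactor.\<close>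

lemma engset_avoid_bounds:
  assumes X: "engset_process N C \<nu> \<mu> M X"
    and par: "0 < \<nu>" "\<nu> < 1" "\<mu> = 1 - \<nu>" and C: "1 \<le> C" "C \<le> N"
    and start: "AE \<omega> in M. X 0 \<omega> = C" and t: "t \<ge> 0"
  shows "exp (- t / engset_mean N C \<nu> 1) \<le> \<P>(\<omega> in M. \<forall>s\<in>{0..t}. X s \<omega> \<noteq> 0)"
    and "\<P>(\<omega> in M. \<forall>s\<in>{0..t}. X s \<omega> \<noteq> 0) \<le>
      exp (- t / engset_mean N C \<nu> C) * engset_mean N C \<nu> C / engset_mean N C \<nu> 1"
    and "\<P>(\<omega> in M. enn2real (hitting_time X 0 \<omega>) \<le> t) = 1 - \<P>(\<omega> in M. \<forall>s\<in>{0..t}. X s \<omega> \<noteq> 0)"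
    and "hitting_time X 0 \<in> borel_measurable M"
proof -
  obtain P where P: "markov_transition_function {0..C} P"
      "has_transition_rates {0..C} P (engset_rate N C \<nu> \<mu>)" "markov_property M {0..C} P X"
    and pM: "prob_space M" and meas: "\<And>t. t \<ge> 0 \<Longrightarrow> X t \<in> M \<rightarrow>\<^sub>M count_space {0..C}"
    and rc: "\<And>\<omega> t. \<omega> \<in> space M \<Longrightarrow> t \<ge> 0 \<Longrightarrow> continuous (at_right t) (\<lambda>s. X s \<omega>)"
    using X unfolding engset_process_def finite_markov_process_def by blast
  interpret prob_space M by (rule pM)
  interpret finite_state_markov M "{0..C}" P X "engset_rate N C \<nu> \<mu>"
    by unfold_locales (use P meas rc in auto)
  let ?m = "engset_mean N C \<nu>"
  have m1: "?m 1 > 0" using engset_mean_1_pos par C by blast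
  have mC: "?m C \<ge> ?m 1" using engset_mean_mono par C by blast
  have range: "?m 1 \<le> ?m x \<and> ?m x \<le> ?m C" if "x \<in> {0..C} - {0}" for x
    using that par by (auto intro!: engset_mean_mono)
  have gen: "(\<Sum>y\<in>{0..C}-{x}. engset_rate N C \<nu> \<mu> x y * (?m y - ?m x)) = -1" if "x \<in> {0..C} - {0}" for x
    using engset_mean_generator[OF par(1,2) C that] by (simp add: par(3))
  have C0: "C \<in> {0..C} - {0}" using C by auto
  have m0: "?m 0 = 0" by (simp add: engset_mean_def)
  note bounds = avoid_prob_bounds[of ?m 0 "?m 1" "?m C" C, OF m0 range m1 gen start C0]
  show "exp (- t / ?m 1) \<le> \<P>(\<omega> in M. \<forall>s\<in>{0..t}. X s \<omega> \<noteq> 0)"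
    using bounds(1)[OF _ _ t] m1 mC by simp
  have upper: "\<P>(\<omega> in M. \<forall>s\<in>{0..t}. X s \<omega> \<noteq> 0) \<le> exp (- t / ?m C) * ?m C / ?m 1" if "t \<ge> 0" for t
    using bounds(2)[OF _ _ that] by simp
  then show "\<P>(\<omega> in M. \<forall>s\<in>{0..t}. X s \<omega> \<noteq> 0) \<le> exp (- t / ?m C) * ?m C / ?m 1"
    using t by blast
  \<comment> \<open>For a fixed process the upper bound decays in \<open>t\<close>, which gives the
    almost sure finiteness behind the distribution function.\<close>
  have "((\<lambda>t. \<P>(\<omega> in M. \<forall>s\<in>{0..t}. X s \<omega> \<noteq> 0)) \<longlongrightarrow> 0) at_top"
  proof (rule tendsto_sandwich[where f = "\<lambda>_. 0"])
    show "eventually (\<lambda>t. \<P>(\<omega> in M. \<forall>s\<in>{0..t}. X s \<omega> \<noteq> 0) \<le> exp (- t / ?m C) * ?m C / ?m 1) at_top"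
      using eventually_ge_at_top[of 0] by eventually_elim (rule upper)
    have "?m C > 0" using m1 mC by linarith
    then show "((\<lambda>t. exp (- t / ?m C) * ?m C / ?m 1) \<longlongrightarrow> 0) at_top"
      using m1 by real_asymp
  qed auto
  then show "\<P>(\<omega> in M. enn2real (hitting_time X 0 \<omega>) \<le> t) = 1 - \<P>(\<omega> in M. \<forall>s\<in>{0..t}. X s \<omega> \<noteq> 0)"
    using t by (intro prob_hitting_time_le)
  show "hitting_time X 0 \<in> borel_measurable M"
    by (rule measurable_hitting_time)
qed

theorem proposition9:
  fixes \<mu> \<nu> \<eta> :: real
    and C :: "nat \<Rightarrow> nat"
    and M :: "nat \<Rightarrow> 'a measure"
    and X :: "nat \<Rightarrow> real \<Rightarrow> 'a \<Rightarrow> nat"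
  assumes "\<mu> > 0" and "\<nu> > 0" and "\<mu> + \<nu> = 1"
    and "\<And>N. N \<ge> 1 \<Longrightarrow> 1 \<le> C N \<and> C N \<le> N"
    and "\<And>N. N \<ge> 1 \<Longrightarrow> engset_process N (C N) \<nu> \<mu> (M N) (X N)"
    and "\<And>N. N \<ge> 1 \<Longrightarrow> AE \<omega> in M N. X N 0 \<omega> = C N"
    and "0 < \<eta>" and "\<eta> \<le> 1" and "\<nu> < \<eta>"
    and "(\<lambda>N. real (C N) - \<eta> * real N) \<in> O(\<lambda>_. 1)"
  shows "weak_conv_m
           (\<lambda>N. distr (M N) borel
              (\<lambda>\<omega>. real N * (1 - \<nu>) ^ N * enn2real (hitting_time (X N) 0 \<omega>)))
           (density lborel (exponential_density \<nu>))"
proof -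
  have \<nu>: "0 < \<nu>" "\<nu> < 1" "\<mu> = 1 - \<nu>" using assms(1-3) by auto
  define a where "a N = real N * (1 - \<nu>) ^ N" for N
  define p where "p N t = \<P>(\<omega> in M N. \<forall>s\<in>{0..t}. X N s \<omega> \<noteq> 0)" for N t
  let ?m = "\<lambda>N. engset_mean N (C N) \<nu>"
  let ?D = "\<lambda>N. distr (M N) borel (\<lambda>\<omega>. a N * enn2real (hitting_time (X N) 0 \<omega>))"
  have apos: "a N > 0" if "N \<ge> 1" for N using that \<nu> by (simp add: a_def)
  have C: "1 \<le> C N" "C N \<le> N" if "N \<ge> 1" for N using assms(4)[OF that] by auto
  note engset = engset_avoid_bounds[OF assms(5) \<nu> C assms(6)]

  \<comment> \<open>Half of the gap between \<open>\<eta>\<close> and \<open>\<nu>\<close> is kept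
    as the margin; the other half absorbs the bounded error of \<open>C N\<close>.\<close>
  define \<delta> where "\<delta> = (\<eta> - \<nu>) / 2"
  have \<delta>: "\<delta> > 0" using assms(9) by (simp add: \<delta>_def)
  have large: "eventually (\<lambda>N. real (C N) \<ge> \<nu> * real N + \<delta> * real N \<and> C N \<le> N) sequentially"
  proof -
    obtain c where c: "eventually (\<lambda>N. \<bar>real (C N) - \<eta> * real N\<bar> \<le> c) sequentially"
      using landau_o.bigE[OF assms(10)] by auto
    have "filterlim (\<lambda>N. \<delta> * real N) at_top sequentially" using \<delta> by real_asymp
    then have "eventually (\<lambda>N. c \<le> \<delta> * real N) sequentially" by (simp add: filterlim_at_top)
    then show ?thesis using c eventually_ge_at_top[of 1]
    proof eventually_elim
      case (elim N)
      have "\<eta> * real N = \<nu> * real N + 2 * (\<delta> * real N)" by (simp add: \<delta>_def field_simps)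
      then show ?case using elim C(2)[OF elim(3)] by linarith
    qed
  qed
  have lim1: "(\<lambda>N. a N * ?m N 1) \<longlonglongrightarrow> 1 / \<nu>"
    unfolding a_def by (rule engset_mean_1_tendsto[OF \<nu>(1,2) \<delta> large])
  have limC: "(\<lambda>N. a N * ?m N (C N)) \<longlonglongrightarrow> 1 / \<nu>"
    unfolding a_def by (rule engset_mean_top_tendsto[OF \<nu>(1,2) \<delta> large])

  \<comment> \<open>At time \<open>x / a N\<close> the exponents become \<open>- x\<close> divided
    by a normalized mean, and both normalized means tend to \<open>1 / \<nu>\<close>.\<close>
  have p_lim: "(\<lambda>N. p N (x / a N)) \<longlonglongrightarrow> exp (- \<nu> * x)" if x: "x \<ge> 0" for x
  proof (rule tendsto_sandwich)
    have xa: "x / a N \<ge> 0" if "N \<ge> 1" for N using x apos[OF that] by simp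
    show "eventually (\<lambda>N. exp (- x / (a N * ?m N 1)) \<le> p N (x / a N)) sequentially"
      using eventually_ge_at_top[of 1]
    proof eventually_elim
      case (elim N)
      show ?case using engset(1)[OF elim elim elim elim xa[OF elim]] by (simp add: p_def)
    qed
    show "eventually (\<lambda>N. p N (x / a N) \<le>
        exp (- x / (a N * ?m N (C N))) * (a N * ?m N (C N)) / (a N * ?m N 1)) sequentially"
      using eventually_ge_at_top[of 1]
    proof eventually_elim
      case (elim N)
      show ?case using engset(2)[OF elim elim elim elim xa[OF elim]] apos[OF elim] by (simp add: p_def)
    qed
    have "(\<lambda>N. exp (- x / (a N * ?m N 1))) \<longlonglongrightarrow> exp (- x / (1 / \<nu>))"
      using \<nu> by (intro tendsto_intros lim1) auto
    then show "(\<lambda>N. exp (- x / (a N * ?m N 1))) \<longlonglongrightarrow> exp (- \<nu> * x)"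
      by (simp add: mult.commute)
    \<comment> \<open>The prefactor is a quotient of two normalized means with the same nonzero
      limit, so it tends to 1.\<close>
    have "(\<lambda>N. exp (- x / (a N * ?m N (C N))) * (a N * ?m N (C N)) / (a N * ?m N 1))
        \<longlonglongrightarrow> exp (- x / (1 / \<nu>)) * (1 / \<nu>) / (1 / \<nu>)"
      using \<nu> by (intro tendsto_intros lim1 limC) auto
    then show "(\<lambda>N. exp (- x / (a N * ?m N (C N))) * (a N * ?m N (C N)) / (a N * ?m N 1))
        \<longlonglongrightarrow> exp (- \<nu> * x)"
      using \<nu> by (simp add: mult.commute)
  qed

  have cdf: "cdf (?D N) x = (if x < 0 then 0 else 1 - p N (x / a N))" if N: "N \<ge> 1" for N x
  proof -
    have [measurable]: "hitting_time (X N) 0 \<in> borel_measurable (M N)"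
      using engset(4)[OF N N N N order_refl] .
    have "cdf (?D N) x = \<P>(\<omega> in M N. a N * enn2real (hitting_time (X N) 0 \<omega>) \<le> x)"
      unfolding cdf_def2 by (subst measure_distr) (auto simp: vimage_def Int_def conj_commute)
    also have "\<dots> = (if x < 0 then 0 else 1 - p N (x / a N))"
    proof (cases "x < 0")
      case True
      have "a N * enn2real (hitting_time (X N) 0 \<omega>) \<ge> 0" for \<omega> using apos[OF N] by simp
      then have "{\<omega>\<in>space (M N). a N * enn2real (hitting_time (X N) 0 \<omega>) \<le> x} = {}"
        using True by (auto simp: not_le intro: less_le_trans)
      then show ?thesis using True by (simp only: measure_empty if_True)
    next
      case False
      then have "x / a N \<ge> 0" using apos[OF N] by simp
      moreover have "a N * e \<le> x \<longleftrightarrow> e \<le> x / a N" for e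
        using apos[OF N] by (simp add: pos_le_divide_eq mult.commute)
      ultimately show ?thesis using engset(3)[OF N N N N] False
        by (simp only: p_def if_False)
    qed
    finally show ?thesis .
  qed
  have "weak_conv_m ?D (density lborel (exponential_density \<nu>))"
    unfolding weak_conv_m_def weak_conv_def cdf_exponential[OF \<nu>(1)]
  proof (intro allI impI)
    fix x :: real
    have "(\<lambda>N. if x < 0 then 0 else 1 - p N (x / a N)) \<longlonglongrightarrow> (if x < 0 then 0 else 1 - exp (- \<nu> * x))"
      using p_lim[of x] by (auto intro!: tendsto_intros)
    \<comment> \<open>The formula \<open>cdf\<close> is available only for \<open>N \<ge> 1\<close>,
      so the two sequences are compared eventually.\<close>
    then show "(\<lambda>N. cdf (?D N) x) \<longlonglongrightarrow> (if x < 0 then 0 else 1 - exp (- \<nu> * x))"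
      by (rule Lim_transform_eventually)
        (auto intro!: eventually_mono[OF eventually_ge_at_top[of 1]] simp: cdf)
  qed
  then show ?thesis by (simp add: a_def)
qed

end
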